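(* The following three $\mathbb{S}$-collections, equipped with the compositions $\{\circ_i\}$, are suboperads of $(\mathsf{scpx},\{\circ_i\})$ and of $(\mathsf{scpx}_{\neq\emptyset},\{\circ_i\})$: (1) $\mathcal{T}_n=\{\{\emptyset\}\}$, $n\ge1$, whose only operation of arity $n$ is the trivial simplicial complex $\{\emptyset\}$ on $n$ vertices (non-unital); (2) $\mathcal{D}_n=\{\{\emptyset,\{1\},\dots,\{n\}\}\}$, $n\ge1$, whose only operation of arity $n$ is the simplicial complex consisting of $n$ discrete points (unital); (3) $\mathcal{S}_n=\{\Delta_{[n]}\}$, $n\ge1$, whose only operation of arity $n$ is the simplex of all subsets of $[n]$ (unital). Furthermore, these operads are isomorphic to $\mathit{Com}$.
   Context: For $n\ge1$ let $[n]=\{1,\dots,n\}$. $\mathsf{scpx}(n)$ is the set of families of subsets of $[n]$ closed under taking subsets (simplicial complexes on $[n]$, the empty family being allowed), and $\mathsf{scpx}_{\neq\emptyset}(n)$ the subset of those different from the empty family; $\mathbb{S}_n$ acts by relabelling. For $I\subseteq[n]$, $J\subseteq[m]$, $k\in[n]$, with $I^{<k}=\{i\in I\mid i<k\}$, $I^{>k}=\{i\in I\mid i>k\}$, $I+\ell=\{i+\ell\mid i\in I\}$, put $I\circ_kJ=I^{<k}\sqcup(J+k-1)\sqcup(I^{>k}+m-1)$ if $k\in I$ and $I\circ_kJ=I^{<k}\sqcup(I^{>k}+m-1)$ if $k\notin I$. The substitution operad has compositions $K\circ_kL=\{I\circ_kJ\mid I\in K,J\in L\}$ and unit $\{\emptyset,\{1\}\}$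 on $[1]$. $\mathit{Com}$ is the commutative set operad with exactly one operation in each arity $n\ge1$ (trivial $\mathbb{S}_n$-action) and none in arity $0$. "Unital" means the suboperad contains the unit of the ambient operad; in the non-unital case, suboperad and isomorphism are meant in the category of non-unital operads. *)

theory Defs
  imports "HOL-Combinatorics.Permutations"
begin

section \<open>Symmetric set operads via partial compositions\<close>

text \<open>
  \<open>pcomp P n m k x y\<close> is \<open>x \<circ>\<^sub>k y\<close> for \<open>x\<close> of arity \<open>n\<close> and \<open>y\<close> of arity \<open>m\<close>.
  The symmetric groups, i.e. the \<open>\<sigma>\<close> with \<open>\<sigma> permutes {1..n}\<close>, act from the left; the
  usual right action is \<open>x \<cdot> \<sigma> = act P n (inv \<sigma>) x\<close>.
\<close>

record 'a operad_data =
  ops :: "nat \<Rightarrow> 'a set"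
  act :: "nat \<Rightarrow> (nat \<Rightarrow> nat) \<Rightarrow> 'a \<Rightarrow> 'a"
  pcomp :: "nat \<Rightarrow> nat \<Rightarrow> nat \<Rightarrow> 'a \<Rightarrow> 'a \<Rightarrow> 'a"

record 'a unital_operad_data = "'a operad_data" +
  op_unit :: 'a

text \<open>
  In \<open>x \<circ>\<^sub>k y\<close> the input \<open>i \<noteq> k\<close> of \<open>x\<close> becomes the input \<open>outer_pos m k i\<close>, and the input \<open>j\<close>
  of \<open>y\<close> becomes \<open>j + k - 1\<close>. The permutation \<open>perm_pcomp n m k \<sigma> \<tau>\<close> of \<open>{1..n + m - 1}\<close>
  moves the inputs of \<open>x\<close> other than \<open>k\<close> by \<open>\<sigma>\<close> and those of \<open>y\<close> by \<open>\<tau>\<close>,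
  with the image block inserted at \<open>\<sigma> k\<close>.
\<close>

definition outer_pos :: "nat \<Rightarrow> nat \<Rightarrow> nat \<Rightarrow> nat" where
  "outer_pos m k i = (if i < k then i else i + m - 1)"

definition perm_pcomp ::
  "nat \<Rightarrow> nat \<Rightarrow> nat \<Rightarrow> (nat \<Rightarrow> nat) \<Rightarrow> (nat \<Rightarrow> nat) \<Rightarrow> nat \<Rightarrow> nat" where
  "perm_pcomp n m k \<sigma> \<tau> a =
     (if a \<notin> {1..n + m - 1} then a
      else if a < k then outer_pos m (\<sigma> k) (\<sigma> a)
      else if a < k + m then \<tau> (a + 1 - k) + \<sigma> k - 1
      else outer_pos m (\<sigma> k) (\<sigma> (a + 1 - m)))"

locale nonunital_operad =
  fixes P :: "('a, 'z) operad_data_scheme"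
  assumes act_closed:
      "\<lbrakk>\<sigma> permutes {1..n}; x \<in> ops P n\<rbrakk> \<Longrightarrow> act P n \<sigma> x \<in> ops P n"
    and act_id: "x \<in> ops P n \<Longrightarrow> act P n id x = x"
    and act_comp:
      "\<lbrakk>\<sigma> permutes {1..n}; \<tau> permutes {1..n}; x \<in> ops P n\<rbrakk>
        \<Longrightarrow> act P n (\<sigma> \<circ> \<tau>) x = act P n \<sigma> (act P n \<tau> x)"
    and pcomp_closed:
      "\<lbrakk>x \<in> ops P n; y \<in> ops P m; k \<in> {1..n}\<rbrakk> \<Longrightarrow> pcomp P n m k x y \<in> ops P (n + m - 1)"
    and pcomp_sequential:
      "\<lbrakk>x \<in> ops P n; y \<in> ops P m; z \<in> ops P l; i \<in> {1..n}; j \<in> {1..m}\<rbrakk>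
        \<Longrightarrow> pcomp P (n + m - 1) l (i + j - 1) (pcomp P n m i x y) z
          = pcomp P n (m + l - 1) i x (pcomp P m l j y z)"
    and pcomp_parallel:
      "\<lbrakk>x \<in> ops P n; y \<in> ops P m; z \<in> ops P l; i \<in> {1..n}; k \<in> {1..n}; i < k\<rbrakk>
        \<Longrightarrow> pcomp P (n + m - 1) l (k + m - 1) (pcomp P n m i x y) z
          = pcomp P (n + l - 1) m i (pcomp P n l k x z) y"
    and pcomp_equivariant:
      "\<lbrakk>x \<in> ops P n; y \<in> ops P m; k \<in> {1..n}; \<sigma> permutes {1..n}; \<tau> permutes {1..m}\<rbrakk>
        \<Longrightarrow> pcomp P n m (\<sigma> k) (act P n \<sigma> x) (act P m \<tau> y)
          = act P (n + m - 1) (perm_pcomp n m k \<sigma> \<tau>) (pcomp P n m k x y)"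

locale unital_operad = nonunital_operad P
  for P :: "('a, 'z) unital_operad_data_scheme" +
  assumes unit_closed: "op_unit P \<in> ops P 1"
    and unit_right: "\<lbrakk>x \<in> ops P n; k \<in> {1..n}\<rbrakk> \<Longrightarrow> pcomp P n 1 k x (op_unit P) = x"
    and unit_left: "x \<in> ops P n \<Longrightarrow> pcomp P 1 n 1 (op_unit P) x = x"

definition nonunital_suboperad ::
  "(nat \<Rightarrow> 'a set) \<Rightarrow> ('a, 'z) operad_data_scheme \<Rightarrow> bool" where
  "nonunital_suboperad Q P \<longleftrightarrow>
     nonunital_operad P \<and>
     (\<forall>n. Q n \<subseteq> ops P n) \<and>
     (\<forall>n \<sigma>. \<forall>x \<in> Q n. \<sigma> permutes {1..n} \<longrightarrow> act P n \<sigma> x \<in> Q n) \<and>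
     (\<forall>n m. \<forall>k \<in> {1..n}. \<forall>x \<in> Q n. \<forall>y \<in> Q m. pcomp P n m k x y \<in> Q (n + m - 1))"

definition unital_suboperad ::
  "(nat \<Rightarrow> 'a set) \<Rightarrow> ('a, 'z) unital_operad_data_scheme \<Rightarrow> bool" where
  "unital_suboperad Q P \<longleftrightarrow>
     unital_operad P \<and> nonunital_suboperad Q P \<and> op_unit P \<in> Q 1"

definition nonunital_operad_hom ::
  "(nat \<Rightarrow> 'a \<Rightarrow> 'b) \<Rightarrow> ('a, 'y) operad_data_scheme \<Rightarrow> ('b, 'z) operad_data_scheme \<Rightarrow> bool" where
  "nonunital_operad_hom f P Q \<longleftrightarrow>
     (\<forall>n. \<forall>x \<in> ops P n. f n x \<in> ops Q n) \<and>
     (\<forall>n \<sigma>. \<forall>x \<in> ops P n. \<sigma> permutes {1..n} \<longrightarrow> f n (act P n \<sigma> x) = act Q n \<sigma> (f n x)) \<and>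
     (\<forall>n m. \<forall>k \<in> {1..n}. \<forall>x \<in> ops P n. \<forall>y \<in> ops P m.
        f (n + m - 1) (pcomp P n m k x y) = pcomp Q n m k (f n x) (f m y))"

definition nonunital_operad_iso ::
  "('a, 'y) operad_data_scheme \<Rightarrow> ('b, 'z) operad_data_scheme \<Rightarrow> bool" where
  "nonunital_operad_iso P Q \<longleftrightarrow>
     nonunital_operad P \<and> nonunital_operad Q \<and>
     (\<exists>f. nonunital_operad_hom f P Q \<and> (\<forall>n. bij_betw (f n) (ops P n) (ops Q n)))"

definition unital_operad_iso ::
  "('a, 'y) unital_operad_data_scheme \<Rightarrow> ('b, 'z) unital_operad_data_scheme \<Rightarrow> bool" where
  "unital_operad_iso P Q \<longleftrightarrow>
     unital_operad P \<and> unital_operad Q \<and>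
     (\<exists>f. nonunital_operad_hom f P Q \<and> f 1 (op_unit P) = op_unit Q \<and>
        (\<forall>n. bij_betw (f n) (ops P n) (ops Q n)))"

definition Com :: "unit unital_operad_data" where
  "Com = \<lparr>ops = (\<lambda>n. if n \<ge> 1 then {()} else {}),
          act = (\<lambda>n \<sigma> x. x),
          pcomp = (\<lambda>n m k x y. ()),
          op_unit = ()\<rparr>"

section \<open>The substitution operad of simplicial complexes\<close>

text \<open>All collections of complexes below are empty in arity \<open>0\<close>.\<close>

definition scpx :: "nat \<Rightarrow> nat set set set" where
  "scpx n = (if n \<ge> 1 then {K. K \<subseteq> Pow {1..n} \<and> (\<forall>I \<in> K. \<forall>J. J \<subseteq> I \<longrightarrow> J \<in> K)} else {})"

definition scpx_ne :: "nat \<Rightarrow> nat set set set" where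
  "scpx_ne n = {K \<in> scpx n. K \<noteq> {}}"

definition set_subst :: "nat \<Rightarrow> nat \<Rightarrow> nat set \<Rightarrow> nat set \<Rightarrow> nat set" where
  "set_subst m k I J =
     (if k \<in> I
      then {i \<in> I. i < k} \<union> (\<lambda>j. j + k - 1) ` J \<union> (\<lambda>i. i + m - 1) ` {i \<in> I. i > k}
      else {i \<in> I. i < k} \<union> (\<lambda>i. i + m - 1) ` {i \<in> I. i > k})"

definition scpx_operad :: "nat set set unital_operad_data" where
  "scpx_operad =
     \<lparr>ops = scpx,
      act = (\<lambda>n \<sigma> K. (\<lambda>I. \<sigma> ` I) ` K),
      pcomp = (\<lambda>n m k K L. {set_subst m k I J | I J. I \<in> K \<and> J \<in> L}),
      op_unit = {{}, {1}}\<rparr>"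

definition scpx_ne_operad :: "nat set set unital_operad_data" where
  "scpx_ne_operad = scpx_operad\<lparr>ops := scpx_ne\<rparr>"

definition trivial_complexes :: "nat \<Rightarrow> nat set set set" where
  "trivial_complexes n = (if n \<ge> 1 then {{{}}} else {})"

definition discrete_complexes :: "nat \<Rightarrow> nat set set set" where
  "discrete_complexes n = (if n \<ge> 1 then {{{}} \<union> (\<lambda>i. {i}) ` {1..n}} else {})"

definition simplex_complexes :: "nat \<Rightarrow> nat set set set" where
  "simplex_complexes n = (if n \<ge> 1 then {Pow {1..n}} else {})"

end

theory Submission
  imports Defs
begin

text \<open>
  The work lies in showing that \<open>scpx_operad\<close> is an operad at all. Everything reduces to the
  substitution \<open>I \<circ>\<^sub>k J\<close> of single faces, since composition and action of complexes are defined
  facewise. Two descriptions of \<open>I \<circ>\<^sub>k J\<close> are used. As a union of images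
  (\<open>set_subst_eq_images\<close>), it is the image of \<open>I - {k}\<close> under the renumbering of the outer inputs
  together with, when \<open>k \<in> I\<close>, the image of \<open>J\<close> under the renumbering of the inner inputs;
  in this form equivariance and closure under subsets become pointwise facts. As a condition on
  positions (\<open>mem_set_subst_iff\<close>), whether \<open>a\<close> lies in \<open>I \<circ>\<^sub>k J\<close> is read off from \<open>I\<close> and \<open>J\<close>
  by a rule that depends on the block containing \<open>a\<close>; in this form both associativity laws
  become, block by block, linear arithmetic.

  A suboperad is an operad by restriction, and an operad with exactly one operation in each
  positive arity and none in arity \<open>0\<close> is isomorphic to \<open>Com\<close>, all equations being between
  elements of singletons. It remains to see that \<open>{\<emptyset>}\<close>, the discrete complexes and the simplices
  are stable under action and composition. For \<open>{\<emptyset>}\<close> this is \<open>\<emptyset> \<circ>\<^sub>k \<emptyset> = \<emptyset>\<close>. For the last two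
  families the composites are discrete and full, respectively, on the same vertex set:
  the outer inputs other than \<open>k\<close> and the inner inputs together fill
  \<open>{1..n + m - 1}\<close> (\<open>set_subst_full\<close>). The nonempty complexes form a
  suboperad of all complexes, and the three families lie in it.
\<close>

section \<open>Suboperads and operads with one operation per arity\<close>

lemma nonunital_operad_restrict:
  fixes P :: "('a, 'z) operad_data_scheme"
  assumes "nonunital_suboperad Q P"
  shows "nonunital_operad (P\<lparr>ops := Q\<rparr>)"
proof -
  interpret P: nonunital_operad P
    using assms by (simp add: nonunital_suboperad_def)
  have sub: "x \<in> ops P n" if "x \<in> Q n" for x n
    using assms that by (auto simp: nonunital_suboperad_def)
  have act_Q: "act P n \<sigma> x \<in> Q n" if "\<sigma> permutes {1..n}" "x \<in> Q n" for n \<sigma> x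
    using assms that by (simp add: nonunital_suboperad_def)
  have pcomp_Q: "pcomp P n m k x y \<in> Q (n + m - 1)"
    if "x \<in> Q n" "y \<in> Q m" "k \<in> {1..n}" for n m k x y
    using assms that unfolding nonunital_suboperad_def by blast
  have restrict: "ops (P\<lparr>ops := Q\<rparr>) = Q" "act (P\<lparr>ops := Q\<rparr>) = act P" "pcomp (P\<lparr>ops := Q\<rparr>) = pcomp P"
    by simp_all
  show ?thesis
    by unfold_locales
      (unfold restrict; intro act_Q pcomp_Q P.act_id P.act_comp P.pcomp_sequential
        P.pcomp_parallel P.pcomp_equivariant; (assumption | erule sub))+
qed

lemma unital_operad_restrict:
  fixes P :: "('a, 'z) unital_operad_data_scheme"
  assumes "unital_suboperad Q P"
  shows "unital_operad (P\<lparr>ops := Q\<rparr>)"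
proof -
  interpret P: unital_operad P
    using assms by (simp add: unital_suboperad_def)
  have sub: "x \<in> ops P n" if "x \<in> Q n" for x n
    using assms that by (auto simp: unital_suboperad_def nonunital_suboperad_def)
  interpret Q: nonunital_operad "P\<lparr>ops := Q\<rparr>"
    using assms by (intro nonunital_operad_restrict) (simp add: unital_suboperad_def)
  show ?thesis
  proof unfold_locales
    show "op_unit (P\<lparr>ops := Q\<rparr>) \<in> ops (P\<lparr>ops := Q\<rparr>) 1"
      using assms by (simp add: unital_suboperad_def)
  next
    fix x n k assume "x \<in> ops (P\<lparr>ops := Q\<rparr>) n" "k \<in> {1..n}"
    then show "pcomp (P\<lparr>ops := Q\<rparr>) n 1 k x (op_unit (P\<lparr>ops := Q\<rparr>)) = x"
      using P.unit_right[OF sub] by simp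
  next
    fix x n assume "x \<in> ops (P\<lparr>ops := Q\<rparr>) n"
    then show "pcomp (P\<lparr>ops := Q\<rparr>) 1 n 1 (op_unit (P\<lparr>ops := Q\<rparr>)) x = x"
      using P.unit_left[OF sub] by simp
  qed
qed

lemma nonunital_suboperad_of_suboperad:
  fixes P :: "('a, 'z) operad_data_scheme"
  assumes "nonunital_suboperad Q P" "nonunital_suboperad R P" "\<And>n. Q n \<subseteq> R n"
  shows "nonunital_suboperad Q (P\<lparr>ops := R\<rparr>)"
  using assms(1,3) nonunital_operad_restrict[OF assms(2)]
  by (simp add: nonunital_suboperad_def)

lemma unital_suboperad_of_suboperad:
  fixes P :: "('a, 'z) unital_operad_data_scheme"
  assumes "unital_suboperad Q P" "unital_suboperad R P" "\<And>n. Q n \<subseteq> R n"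
  shows "unital_suboperad Q (P\<lparr>ops := R\<rparr>)"
  using assms(1,3) unital_operad_restrict[OF assms(2)]
    nonunital_suboperad_of_suboperad[of Q P R] assms(2)
  by (simp add: unital_suboperad_def)

lemma unital_operad_Com: "unital_operad Com"
  by unfold_locales (auto simp: Com_def split: if_splits)

lemma nonunital_operad_hom_to_Com:
  fixes P :: "('a, 'z) operad_data_scheme"
  assumes "ops P 0 = {}"
  shows "nonunital_operad_hom (\<lambda>n x. ()) P Com"
proof -
  have "n \<ge> 1" if "x \<in> ops P n" for x n
    using assms that by (cases n) auto
  then show ?thesis
    by (auto simp: nonunital_operad_hom_def Com_def)
qed

lemma bij_betw_to_Com:
  assumes "Q = (\<lambda>n. if n \<ge> 1 then {c n} else {})"
  shows "bij_betw (\<lambda>x. ()) (Q n) (ops Com n)"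
  by (cases "n \<ge> 1") (simp_all add: assms Com_def bij_betw_def)

lemma nonunital_iso_Com_if_singletons:
  fixes P :: "('a, 'z) operad_data_scheme"
  assumes "nonunital_suboperad Q P" and Q: "Q = (\<lambda>n. if n \<ge> 1 then {c n} else {})"
  shows "nonunital_operad_iso (P\<lparr>ops := Q\<rparr>) Com"
  unfolding nonunital_operad_iso_def
proof (intro conjI exI allI)
  show "nonunital_operad (P\<lparr>ops := Q\<rparr>)"
    using assms(1) by (rule nonunital_operad_restrict)
  show "nonunital_operad Com"
    using unital_operad_Com by (simp add: unital_operad_def)
  show "nonunital_operad_hom (\<lambda>n x. ()) (P\<lparr>ops := Q\<rparr>) Com"
    by (rule nonunital_operad_hom_to_Com) (simp add: Q)
  show "bij_betw (\<lambda>x. ()) (ops (P\<lparr>ops := Q\<rparr>) n) (ops Com n)" for n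
    using bij_betw_to_Com[OF Q] by simp
qed

lemma unital_iso_Com_if_singletons:
  fixes P :: "('a, 'z) unital_operad_data_scheme"
  assumes "unital_suboperad Q P" and Q: "Q = (\<lambda>n. if n \<ge> 1 then {c n} else {})"
  shows "unital_operad_iso (P\<lparr>ops := Q\<rparr>) Com"
  unfolding unital_operad_iso_def
proof (intro conjI exI allI)
  show "unital_operad (P\<lparr>ops := Q\<rparr>)"
    using assms(1) by (rule unital_operad_restrict)
  show "unital_operad Com"
    by (rule unital_operad_Com)
  show "nonunital_operad_hom (\<lambda>n x. ()) (P\<lparr>ops := Q\<rparr>) Com"
    by (rule nonunital_operad_hom_to_Com) (simp add: Q)
  show "() = op_unit Com"
    by simp
  show "bij_betw (\<lambda>x. ()) (ops (P\<lparr>ops := Q\<rparr>) n) (ops Com n)" for n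
    using bij_betw_to_Com[OF Q] by simp
qed

section \<open>Substitution of faces\<close>

lemma set_subst_eq_images:
  "set_subst m k I J =
     outer_pos m k ` (I - {k}) \<union> (if k \<in> I then (\<lambda>j. j + k - 1) ` J else {})"
proof -
  have "outer_pos m k ` (I - {k}) =
      outer_pos m k ` {i \<in> I. i < k} \<union> outer_pos m k ` {i \<in> I. i > k}"
    unfolding image_Un[symmetric] by (rule arg_cong[where f = "image _"]) auto
  also have "outer_pos m k ` {i \<in> I. i < k} = {i \<in> I. i < k}"
    by (auto simp: outer_pos_def image_iff)
  also have "outer_pos m k ` {i \<in> I. i > k} = (\<lambda>i. i + m - 1) ` {i \<in> I. i > k}"
    by (rule image_cong) (auto simp: outer_pos_def)
  finally show ?thesis
    by (auto simp: set_subst_def)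
qed

text \<open>
  The positions of the composite split into three blocks: unshifted outer inputs, inner inputs,
  and shifted outer inputs. The bound on \<open>J\<close> keeps the inner inputs inside their block.
\<close>

lemma mem_set_subst_iff:
  assumes "J \<subseteq> {1..m}" "1 \<le> k" "1 \<le> m"
  shows "a \<in> set_subst m k I J \<longleftrightarrow>
    (if a < k then a \<in> I else if a < k + m then k \<in> I \<and> a + 1 - k \<in> J else a + 1 - m \<in> I)"
proof -
  have inner: "a \<in> (\<lambda>j. j + k - 1) ` J \<longleftrightarrow> k \<le> a \<and> a < k + m \<and> a + 1 - k \<in> J"
  proof
    assume "k \<le> a \<and> a < k + m \<and> a + 1 - k \<in> J"
    then show "a \<in> (\<lambda>j. j + k - 1) ` J"
      by (intro image_eqI[of _ _ "a + 1 - k"]) auto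
  qed (use assms in force)
  have outer: "a \<in> (\<lambda>i. i + m - 1) ` {i \<in> I. i > k} \<longleftrightarrow> k + m \<le> a \<and> a + 1 - m \<in> I"
  proof
    assume "k + m \<le> a \<and> a + 1 - m \<in> I"
    then show "a \<in> (\<lambda>i. i + m - 1) ` {i \<in> I. i > k}"
      using assms(3) by (intro image_eqI[of _ _ "a + 1 - m"]) auto
  qed (use assms in force)
  show ?thesis
    by (auto simp: set_subst_def inner outer simp del: One_nat_def)
qed

lemma set_subst_full:
  assumes "k \<in> {1..n}" "1 \<le> m"
  shows "set_subst m k {1..n} {1..m} = {1..n + m - 1}"
proof (rule set_eqI)
  fix a
  show "a \<in> set_subst m k {1..n} {1..m} \<longleftrightarrow> a \<in> {1..n + m - 1}"
    using assms by (subst mem_set_subst_iff) auto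
qed

lemma set_subst_mono:
  assumes "I \<subseteq> I'" "J \<subseteq> J'"
  shows "set_subst m k I J \<subseteq> set_subst m k I' J'"
  using assms unfolding set_subst_def by (auto split: if_splits)

lemma set_subst_bounded:
  assumes "I \<subseteq> {1..n}" "J \<subseteq> {1..m}" "k \<in> {1..n}" "1 \<le> m"
  shows "set_subst m k I J \<subseteq> {1..n + m - 1}"
  using set_subst_mono[OF assms(1,2)] set_subst_full[OF assms(3,4)] by metis

text \<open>
  A subset of \<open>I \<circ>\<^sub>k J\<close> is itself a substitution of subfaces. Keeping \<open>k\<close> in the outer face
  whenever it was there lets the inner face alone record what remains of the inner block,
  including the case where nothing remains.
\<close>

lemma subset_set_substE:
  assumes "H \<subseteq> set_subst m k I J"
  obtains I' J' where "I' \<subseteq> I" "J' \<subseteq> J" "H = set_subst m k I' J'"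
proof
  let ?I = "{i \<in> I. i = k \<or> outer_pos m k i \<in> H}" and ?J = "{j \<in> J. j + k - 1 \<in> H}"
  show "?I \<subseteq> I" "?J \<subseteq> J"
    by auto
  show "H = set_subst m k ?I ?J"
    using assms unfolding set_subst_eq_images by (auto split: if_splits)
qed

text \<open>
  In both associativity laws the two nested substitutions cut the positions into the same five
  consecutive blocks. The proofs fix the block and unfold the membership rule on both sides.
\<close>

lemma set_subst_sequential:
  assumes "J \<subseteq> {1..m}" "L \<subseteq> {1..l}" "i \<in> {1..n}" "j \<in> {1..m}" "1 \<le> l"
  shows "set_subst l (i + j - 1) (set_subst m i I J) L =
    set_subst (m + l - 1) i I (set_subst l j J L)"
proof (rule set_eqI)
  fix a
  have bounded: "set_subst l j J L \<subseteq> {1..m + l - 1}"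
    using assms by (intro set_subst_bounded) auto
  have mem_IJ: "b \<in> set_subst m i I J \<longleftrightarrow>
      (if b < i then b \<in> I else if b < i + m then i \<in> I \<and> b + 1 - i \<in> J else b + 1 - m \<in> I)"
    for b
    using assms by (intro mem_set_subst_iff) auto
  have mem_JL: "b \<in> set_subst l j J L \<longleftrightarrow>
      (if b < j then b \<in> J else if b < j + l then j \<in> J \<and> b + 1 - j \<in> L else b + 1 - l \<in> J)"
    for b
    using assms by (intro mem_set_subst_iff) auto
  have left: "a \<in> set_subst l (i + j - 1) (set_subst m i I J) L \<longleftrightarrow>
      (if a < i + j - 1 then a \<in> set_subst m i I J
       else if a < i + j - 1 + l then i + j - 1 \<in> set_subst m i I J \<and> a + 1 - (i + j - 1) \<in> L
       else a + 1 - l \<in> set_subst m i I J)"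
    using assms by (intro mem_set_subst_iff) auto
  have right: "a \<in> set_subst (m + l - 1) i I (set_subst l j J L) \<longleftrightarrow>
      (if a < i then a \<in> I
       else if a < i + (m + l - 1) then i \<in> I \<and> a + 1 - i \<in> set_subst l j J L
       else a + 1 - (m + l - 1) \<in> I)"
    using assms bounded by (intro mem_set_subst_iff) auto
  have "1 \<le> i" "1 \<le> j" "j \<le> m" "1 \<le> l"
    using assms by auto
  then consider "a < i" | "i \<le> a" "a < i + j - 1" | "i + j - 1 \<le> a" "a < i + j - 1 + l"
    | "i + j - 1 + l \<le> a" "a < i + m + l - 1" | "i + m + l - 1 \<le> a"
    by linarith
  then show "a \<in> set_subst l (i + j - 1) (set_subst m i I J) L \<longleftrightarrow>
      a \<in> set_subst (m + l - 1) i I (set_subst l j J L)"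
    unfolding left right mem_IJ mem_JL
    using \<open>1 \<le> i\<close> \<open>1 \<le> j\<close> \<open>j \<le> m\<close> \<open>1 \<le> l\<close>
    by cases (auto simp: algebra_simps)
qed

lemma set_subst_parallel:
  assumes "J \<subseteq> {1..m}" "L \<subseteq> {1..l}" "1 \<le> i" "i < k" "1 \<le> m" "1 \<le> l"
  shows "set_subst l (k + m - 1) (set_subst m i I J) L =
    set_subst m i (set_subst l k I L) J"
proof (rule set_eqI)
  fix a
  have mem_m: "b \<in> set_subst m i M J \<longleftrightarrow>
      (if b < i then b \<in> M else if b < i + m then i \<in> M \<and> b + 1 - i \<in> J else b + 1 - m \<in> M)"
    for b M
    using assms by (intro mem_set_subst_iff) auto
  have mem_l: "b \<in> set_subst l p M L \<longleftrightarrow>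
      (if b < p then b \<in> M else if b < p + l then p \<in> M \<and> b + 1 - p \<in> L else b + 1 - l \<in> M)"
    if "1 \<le> p" for b p M
    using assms that by (intro mem_set_subst_iff) auto
  have pos: "1 \<le> k" "1 \<le> k + m - 1"
    using assms by auto
  consider "a < i" | "i \<le> a" "a < i + m" | "i + m \<le> a" "a < k + m - 1"
    | "k + m - 1 \<le> a" "a < k + m - 1 + l" | "k + m - 1 + l \<le> a"
    by linarith
  then show "a \<in> set_subst l (k + m - 1) (set_subst m i I J) L \<longleftrightarrow>
      a \<in> set_subst m i (set_subst l k I L) J"
    unfolding mem_l[OF pos(1)] mem_l[OF pos(2)] mem_m
    using assms(3-)
    by cases (auto simp: algebra_simps)
qed

lemma perm_pcomp_outer:
  assumes "i \<in> {1..n}" "i \<noteq> k" "k \<in> {1..n}" "1 \<le> m"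
  shows "perm_pcomp n m k \<sigma> \<tau> (outer_pos m k i) = outer_pos m (\<sigma> k) (\<sigma> i)"
  using assms by (auto simp: perm_pcomp_def outer_pos_def)

lemma perm_pcomp_inner:
  assumes "j \<in> {1..m}" "k \<in> {1..n}"
  shows "perm_pcomp n m k \<sigma> \<tau> (j + k - 1) = \<tau> j + \<sigma> k - 1"
  using assms by (auto simp: perm_pcomp_def)

text \<open>
  Both sides are unions of images, and \<open>perm_pcomp\<close> intertwines the two renumberings. Injectivity
  of \<open>\<sigma>\<close> guarantees that removing the composition slot commutes with relabelling.
\<close>

lemma set_subst_equivariant:
  assumes "I \<subseteq> {1..n}" "J \<subseteq> {1..m}" "k \<in> {1..n}" "1 \<le> m" "inj \<sigma>"
  shows "set_subst m (\<sigma> k) (\<sigma> ` I) (\<tau> ` J) = perm_pcomp n m k \<sigma> \<tau> ` set_subst m k I J"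
proof -
  have slot: "\<sigma> ` I - {\<sigma> k} = \<sigma> ` (I - {k})" "\<sigma> k \<in> \<sigma> ` I \<longleftrightarrow> k \<in> I"
    using \<open>inj \<sigma>\<close> by (auto simp: inj_def)
  have outer: "outer_pos m (\<sigma> k) ` \<sigma> ` (I - {k}) = perm_pcomp n m k \<sigma> \<tau> ` outer_pos m k ` (I - {k})"
    unfolding image_image
    using assms by (intro image_cong refl perm_pcomp_outer[symmetric]) auto
  have inner: "(\<lambda>j. j + \<sigma> k - 1) ` \<tau> ` J = perm_pcomp n m k \<sigma> \<tau> ` (\<lambda>j. j + k - 1) ` J"
    unfolding image_image
    using assms by (intro image_cong refl perm_pcomp_inner[symmetric]) auto
  show ?thesis
    by (simp add: set_subst_eq_images slot outer inner image_Un del: One_nat_def)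
qed

lemma set_subst_empty: "set_subst m k {} J = {}"
  by (simp add: set_subst_eq_images)

lemma set_subst_unit_right:
  "set_subst 1 k I {1} = I" "set_subst 1 k I {} = I - {k}"
proof -
  have "outer_pos 1 k = id"
    by (auto simp: outer_pos_def)
  then show "set_subst 1 k I {1} = I" "set_subst 1 k I {} = I - {k}"
    by (auto simp: set_subst_eq_images)
qed

lemma set_subst_unit_left: "set_subst m 1 {1} J = J"
  by (simp add: set_subst_eq_images)

section \<open>The operad of simplicial complexes\<close>

lemma scpx_operad_simps:
  "ops scpx_operad = scpx"
  "act scpx_operad n \<sigma> K = (\<lambda>I. \<sigma> ` I) ` K"
  "pcomp scpx_operad n m k K L = {set_subst m k I J | I J. I \<in> K \<and> J \<in> L}"
  "op_unit scpx_operad = {{}, {1}}"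
  by (simp_all add: scpx_operad_def)

lemma pcomp_scpx_operad_eq_UN:
  "pcomp scpx_operad n m k K L = (\<Union>I\<in>K. set_subst m k I ` L)"
  by (auto simp: scpx_operad_simps(3))

lemma scpxD:
  assumes "K \<in> scpx n"
  shows "1 \<le> n" "I \<in> K \<Longrightarrow> I \<subseteq> {1..n}" "\<lbrakk>I \<in> K; J \<subseteq> I\<rbrakk> \<Longrightarrow> J \<in> K"
  using assms by (auto simp: scpx_def split: if_splits)

lemma scpxI:
  assumes "1 \<le> n" "\<And>I. I \<in> K \<Longrightarrow> I \<subseteq> {1..n}" "\<And>I J. \<lbrakk>I \<in> K; J \<subseteq> I\<rbrakk> \<Longrightarrow> J \<in> K"
  shows "K \<in> scpx n"
  using assms by (auto simp: scpx_def)

lemma scpx_eq_Pow_if_full_face: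
  assumes "K \<in> scpx n" "{1..n} \<in> K"
  shows "K = Pow {1..n}"
  using scpxD(2,3)[OF assms(1)] assms(2) by blast

lemma act_scpx:
  assumes "\<sigma> permutes {1..n}" "K \<in> scpx n"
  shows "act scpx_operad n \<sigma> K \<in> scpx n"
proof (rule scpxI)
  show "1 \<le> n"
    using assms scpxD by blast
next
  fix I assume "I \<in> act scpx_operad n \<sigma> K"
  then obtain I' where "I = \<sigma> ` I'" "I' \<subseteq> {1..n}"
    using scpxD(2)[OF assms(2)] by (auto simp: scpx_operad_simps)
  then show "I \<subseteq> {1..n}"
    using permutes_image[OF assms(1)] by blast
next
  fix I J assume "I \<in> act scpx_operad n \<sigma> K" "J \<subseteq> I"
  then obtain I' where "I' \<in> K" "J \<subseteq> \<sigma> ` I'"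
    by (auto simp: scpx_operad_simps)
  then obtain J' where "J' \<subseteq> I'" "J = \<sigma> ` J'"
    by (auto simp: subset_image_iff)
  then show "J \<in> act scpx_operad n \<sigma> K"
    using scpxD(3)[OF assms(2) \<open>I' \<in> K\<close>] by (auto simp: scpx_operad_simps)
qed

lemma pcomp_scpx:
  assumes "K \<in> scpx n" "L \<in> scpx m" "k \<in> {1..n}"
  shows "pcomp scpx_operad n m k K L \<in> scpx (n + m - 1)"
proof (rule scpxI)
  show "1 \<le> n + m - 1"
    using scpxD(1)[OF assms(1)] scpxD(1)[OF assms(2)] by simp
next
  fix H assume "H \<in> pcomp scpx_operad n m k K L"
  then show "H \<subseteq> {1..n + m - 1}"
    using set_subst_bounded[OF scpxD(2)[OF assms(1)] scpxD(2)[OF assms(2)] assms(3)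
        scpxD(1)[OF assms(2)]]
    by (auto simp only: scpx_operad_simps mem_Collect_eq)
next
  fix H H' assume "H \<in> pcomp scpx_operad n m k K L" "H' \<subseteq> H"
  then obtain I J where IJ: "I \<in> K" "J \<in> L" "H' \<subseteq> set_subst m k I J"
    by (auto simp only: scpx_operad_simps mem_Collect_eq)
  from IJ(3) obtain I' J' where "I' \<subseteq> I" "J' \<subseteq> J" "H' = set_subst m k I' J'"
    by (rule subset_set_substE)
  then show "H' \<in> pcomp scpx_operad n m k K L"
    using scpxD(3)[OF assms(1) IJ(1)] scpxD(3)[OF assms(2) IJ(2)]
    unfolding scpx_operad_simps by blast
qed

lemma nonunital_operad_scpx: "nonunital_operad scpx_operad"
proof
  show "act scpx_operad n \<sigma> K \<in> ops scpx_operad n"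
    if "\<sigma> permutes {1..n}" "K \<in> ops scpx_operad n" for \<sigma> n K
    using act_scpx that by (simp add: scpx_operad_simps(1))
  show "act scpx_operad n id K = K" for n K
    by (simp add: scpx_operad_simps)
  show "act scpx_operad n (\<sigma> \<circ> \<tau>) K = act scpx_operad n \<sigma> (act scpx_operad n \<tau> K)" for n \<sigma> \<tau> K
    by (simp add: scpx_operad_simps image_image image_comp)
  show "pcomp scpx_operad n m k K L \<in> ops scpx_operad (n + m - 1)"
    if "K \<in> ops scpx_operad n" "L \<in> ops scpx_operad m" "k \<in> {1..n}" for n m k K L
    using pcomp_scpx that by (simp add: scpx_operad_simps(1))
next
  fix x n y m z l i j
  assume "x \<in> ops scpx_operad n" "y \<in> ops scpx_operad m" "z \<in> ops scpx_operad l"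
    and ij: "i \<in> {1..n}" "j \<in> {1..m}"
  then have y: "y \<in> scpx m" and z: "z \<in> scpx l"
    by (simp_all add: scpx_operad_simps)
  have seq: "set_subst l (i + j - 1) (set_subst m i I J) L =
      set_subst (m + l - 1) i I (set_subst l j J L)" if "J \<in> y" "L \<in> z" for I J L
    using set_subst_sequential[OF scpxD(2)[OF y] scpxD(2)[OF z] ij scpxD(1)[OF z]] that .
  have "pcomp scpx_operad (n + m - 1) l (i + j - 1) (pcomp scpx_operad n m i x y) z =
      (\<Union>I\<in>x. \<Union>J\<in>y. set_subst l (i + j - 1) (set_subst m i I J) ` z)"
    unfolding pcomp_scpx_operad_eq_UN by simp
  also have "\<dots> = (\<Union>I\<in>x. \<Union>J\<in>y. (\<lambda>L. set_subst (m + l - 1) i I (set_subst l j J L)) ` z)"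
    by (intro SUP_cong image_cong refl seq)
  also have "\<dots> = pcomp scpx_operad n (m + l - 1) i x (pcomp scpx_operad m l j y z)"
    unfolding pcomp_scpx_operad_eq_UN image_UN image_image ..
  finally show "pcomp scpx_operad (n + m - 1) l (i + j - 1) (pcomp scpx_operad n m i x y) z =
      pcomp scpx_operad n (m + l - 1) i x (pcomp scpx_operad m l j y z)" .
next
  fix x n y m z l i k
  assume "x \<in> ops scpx_operad n" "y \<in> ops scpx_operad m" "z \<in> ops scpx_operad l"
    and ik: "i \<in> {1..n}" "k \<in> {1..n}" "i < k"
  then have y: "y \<in> scpx m" and z: "z \<in> scpx l"
    by (simp_all add: scpx_operad_simps)
  have "1 \<le> i"
    using ik by simp
  then have par: "set_subst l (k + m - 1) (set_subst m i I J) L =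
      set_subst m i (set_subst l k I L) J" if "J \<in> y" "L \<in> z" for I J L
    using set_subst_parallel[OF scpxD(2)[OF y] scpxD(2)[OF z] _ ik(3) scpxD(1)[OF y] scpxD(1)[OF z]]
      that by blast
  have "pcomp scpx_operad (n + m - 1) l (k + m - 1) (pcomp scpx_operad n m i x y) z =
      (\<Union>I\<in>x. \<Union>J\<in>y. set_subst l (k + m - 1) (set_subst m i I J) ` z)"
    unfolding pcomp_scpx_operad_eq_UN by simp
  also have "\<dots> = (\<Union>I\<in>x. \<Union>J\<in>y. (\<lambda>L. set_subst m i (set_subst l k I L) J) ` z)"
    by (intro SUP_cong image_cong refl par)
  also have "\<dots> = (\<Union>I\<in>x. \<Union>L\<in>z. (\<lambda>J. set_subst m i (set_subst l k I L) J) ` y)"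
    by blast
  also have "\<dots> = pcomp scpx_operad (n + l - 1) m i (pcomp scpx_operad n l k x z) y"
    unfolding pcomp_scpx_operad_eq_UN by simp
  finally show "pcomp scpx_operad (n + m - 1) l (k + m - 1) (pcomp scpx_operad n m i x y) z =
      pcomp scpx_operad (n + l - 1) m i (pcomp scpx_operad n l k x z) y" .
next
  fix x n y m k \<sigma> \<tau>
  assume "x \<in> ops scpx_operad n" "y \<in> ops scpx_operad m"
    and k: "k \<in> {1..n}" and \<sigma>: "\<sigma> permutes {1..n}" and "\<tau> permutes {1..m}"
  then have x: "x \<in> scpx n" and y: "y \<in> scpx m"
    by (simp_all add: scpx_operad_simps)
  have equiv: "set_subst m (\<sigma> k) (\<sigma> ` I) (\<tau> ` J) = perm_pcomp n m k \<sigma> \<tau> ` set_subst m k I J"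
    if "I \<in> x" "J \<in> y" for I J
    using set_subst_equivariant[OF scpxD(2)[OF x] scpxD(2)[OF y] k scpxD(1)[OF y]
        permutes_inj[OF \<sigma>]] that .
  have "pcomp scpx_operad n m (\<sigma> k) (act scpx_operad n \<sigma> x) (act scpx_operad m \<tau> y) =
      (\<Union>I\<in>x. (\<lambda>J. set_subst m (\<sigma> k) (\<sigma> ` I) (\<tau> ` J)) ` y)"
    unfolding pcomp_scpx_operad_eq_UN scpx_operad_simps(2) by (simp add: image_image)
  also have "\<dots> = (\<Union>I\<in>x. (\<lambda>J. perm_pcomp n m k \<sigma> \<tau> ` set_subst m k I J) ` y)"
    by (intro SUP_cong image_cong refl equiv)
  also have "\<dots> =
      act scpx_operad (n + m - 1) (perm_pcomp n m k \<sigma> \<tau>) (pcomp scpx_operad n m k x y)"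
    unfolding pcomp_scpx_operad_eq_UN scpx_operad_simps(2) image_UN image_image ..
  finally show "pcomp scpx_operad n m (\<sigma> k) (act scpx_operad n \<sigma> x) (act scpx_operad m \<tau> y) =
      act scpx_operad (n + m - 1) (perm_pcomp n m k \<sigma> \<tau>) (pcomp scpx_operad n m k x y)" .
qed

text \<open>
  The face \<open>{1}\<close> of the unit reproduces the faces of a complex \<open>K\<close>. On the right, the face \<open>\<emptyset>\<close> of
  the unit deletes \<open>k\<close> from the faces of \<open>K\<close>, which yields nothing new because \<open>K\<close> is closed under
  subsets; on the left, it contributes \<open>\<emptyset>\<close>, which lies in \<open>K\<close> as soon as \<open>K\<close> has a face, while
  the composite of an empty \<open>K\<close> is empty.
\<close>

lemma unital_operad_scpx: "unital_operad scpx_operad"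
proof -
  interpret nonunital_operad scpx_operad
    by (rule nonunital_operad_scpx)
  show ?thesis
  proof
    have "{{}, {1}} \<in> scpx 1"
      by (rule scpxI) (auto simp: subset_singleton_iff)
    then show "op_unit scpx_operad \<in> ops scpx_operad 1"
      by (simp add: scpx_operad_simps)
  next
    fix K n k assume "K \<in> ops scpx_operad n"
    then have "I - {k} \<in> K" if "I \<in> K" for I
      using scpxD(3) that by (metis Diff_subset scpx_operad_simps(1))
    moreover have "pcomp scpx_operad n 1 k K (op_unit scpx_operad) =
        (\<lambda>I. set_subst 1 k I {1}) ` K \<union> (\<lambda>I. set_subst 1 k I {}) ` K"
      unfolding scpx_operad_simps by blast
    then have "pcomp scpx_operad n 1 k K (op_unit scpx_operad) = K \<union> (\<lambda>I. I - {k}) ` K"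
      unfolding set_subst_unit_right by simp
    ultimately show "pcomp scpx_operad n 1 k K (op_unit scpx_operad) = K"
      by auto
  next
    fix K n assume "K \<in> ops scpx_operad n"
    then have "{} \<in> K" if "I \<in> K" for I
      using scpxD(3) that by (metis empty_subsetI scpx_operad_simps(1))
    moreover have "pcomp scpx_operad 1 n 1 (op_unit scpx_operad) K =
        (\<lambda>J. set_subst n 1 {1} J) ` K \<union> (\<lambda>J. set_subst n 1 {} J) ` K"
      unfolding scpx_operad_simps by blast
    then have "pcomp scpx_operad 1 n 1 (op_unit scpx_operad) K = K \<union> (\<lambda>I. {}) ` K"
      unfolding set_subst_unit_left set_subst_empty by simp
    ultimately show "pcomp scpx_operad 1 n 1 (op_unit scpx_operad) K = K"
      by auto
  qed
qed

lemma unital_suboperad_scpx_ne: "unital_suboperad scpx_ne scpx_operad"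
proof -
  have "op_unit scpx_operad \<in> scpx_ne 1"
    using unital_operad.unit_closed[OF unital_operad_scpx]
    by (simp add: scpx_ne_def scpx_operad_simps)
  moreover have "act scpx_operad n \<sigma> K \<in> scpx_ne n" if "\<sigma> permutes {1..n}" "K \<in> scpx_ne n" for n \<sigma> K
    using act_scpx that by (auto simp: scpx_ne_def scpx_operad_simps(2))
  moreover have "pcomp scpx_operad n m k K L \<in> scpx_ne (n + m - 1)"
    if "K \<in> scpx_ne n" "L \<in> scpx_ne m" "k \<in> {1..n}" for n m k K L
  proof -
    have "pcomp scpx_operad n m k K L \<noteq> {}"
      using that by (auto simp: scpx_ne_def scpx_operad_simps(3))
    then show ?thesis
      using pcomp_scpx that by (simp add: scpx_ne_def)
  qed
  moreover have "scpx_ne n \<subseteq> ops scpx_operad n" for n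
    by (auto simp: scpx_ne_def scpx_operad_simps(1))
  ultimately show ?thesis
    using unital_operad_scpx nonunital_operad_scpx
    by (simp add: unital_suboperad_def nonunital_suboperad_def)
qed

section \<open>Suboperads with one complex per arity\<close>

lemma complexes_eq:
  "trivial_complexes = (\<lambda>n. if n \<ge> 1 then {{{}}} else {})"
  "discrete_complexes = (\<lambda>n. if n \<ge> 1 then {{{}} \<union> (\<lambda>i. {i}) ` {1..n}} else {})"
  "simplex_complexes = (\<lambda>n. if n \<ge> 1 then {Pow {1..n}} else {})"
  by (rule ext, rule trivial_complexes_def discrete_complexes_def simplex_complexes_def)+

lemma nonunital_suboperad_scpx_singletonsI:
  assumes Q: "Q = (\<lambda>n. if n \<ge> 1 then {c n} else {})"
    and scpx: "\<And>n. 1 \<le> n \<Longrightarrow> c n \<in> scpx n"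
    and act: "\<And>n \<sigma>. \<lbrakk>1 \<le> n; \<sigma> permutes {1..n}\<rbrakk> \<Longrightarrow> (\<lambda>I. \<sigma> ` I) ` c n = c n"
    and pcomp: "\<And>n m k. \<lbrakk>k \<in> {1..n}; 1 \<le> m\<rbrakk> \<Longrightarrow>
      (\<Union>I\<in>c n. set_subst m k I ` c m) = c (n + m - 1)"
  shows "nonunital_suboperad Q scpx_operad"
  unfolding nonunital_suboperad_def
proof (intro conjI allI ballI impI)
  show "nonunital_operad scpx_operad"
    by (rule nonunital_operad_scpx)
  show "Q n \<subseteq> ops scpx_operad n" for n
    using scpx by (simp add: Q scpx_operad_simps(1))
  show "act scpx_operad n \<sigma> x \<in> Q n" if "x \<in> Q n" "\<sigma> permutes {1..n}" for n \<sigma> x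
    using that act by (simp add: Q scpx_operad_simps(2) split: if_splits)
  show "pcomp scpx_operad n m k x y \<in> Q (n + m - 1)"
    if "k \<in> {1..n}" "x \<in> Q n" "y \<in> Q m" for n m k x y
  proof -
    have "1 \<le> n" "x = c n" "1 \<le> m" "y = c m"
      using that(2,3) by (simp_all add: Q split: if_splits)
    then show ?thesis
      using pcomp[OF that(1) \<open>1 \<le> m\<close>] by (simp add: Q pcomp_scpx_operad_eq_UN)
  qed
qed

lemma nonunital_suboperad_trivial: "nonunital_suboperad trivial_complexes scpx_operad"
proof (rule nonunital_suboperad_scpx_singletonsI[OF complexes_eq(1)])
  show "{{}} \<in> scpx n" if "1 \<le> n" for n
    using that by (intro scpxI) auto
qed (auto simp: set_subst_empty)

text \<open>
  Substituting faces with at most one vertex again yields at most one vertex: \<open>\<emptyset> \<circ>\<^sub>k J\<close> is empty,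
  \<open>{k} \<circ>\<^sub>k J\<close> is a shift of \<open>J\<close>, and for \<open>i \<noteq> k\<close> the vertex \<open>{i}\<close> is only renumbered. What
  remains is to see that every vertex of the composite arises in this way.
\<close>

lemma nonunital_suboperad_discrete: "nonunital_suboperad discrete_complexes scpx_operad"
proof (rule nonunital_suboperad_scpx_singletonsI[OF complexes_eq(2)])
  show "{{}} \<union> (\<lambda>i. {i}) ` {1..n} \<in> scpx n" if "1 \<le> n" for n
    using that by (intro scpxI) (auto simp: subset_singleton_iff)
next
  fix n \<sigma> assume \<sigma>: "\<sigma> permutes {1..n::nat}"
  have "(\<lambda>I. \<sigma> ` I) ` ({{}} \<union> (\<lambda>i. {i}) ` {1..n}) = {{}} \<union> (\<lambda>i. {i}) ` \<sigma> ` {1..n}"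
    by (auto simp: image_image image_Un)
  then show "(\<lambda>I. \<sigma> ` I) ` ({{}} \<union> (\<lambda>i. {i}) ` {1..n}) = {{}} \<union> (\<lambda>i. {i}) ` {1..n}"
    using permutes_image[OF \<sigma>] by simp
next
  fix n m k :: nat assume k: "k \<in> {1..n}" and "1 \<le> m"
  let ?D = "\<lambda>n. {{}} \<union> (\<lambda>i. {i}) ` {1..n::nat}"
  have empty: "set_subst m k {} ` ?D m = {{}}"
    by (simp add: set_subst_empty image_constant_conv)
  have "set_subst m k {i} ` ?D m = {{outer_pos m k i}}" if "i \<in> {1..n} - {k}" for i
  proof -
    have "set_subst m k {i} J = {outer_pos m k i}" for J
      using that by (auto simp: set_subst_eq_images)
    then show ?thesis
      by (simp add: image_constant_conv)
  qed
  then have outer: "(\<Union>i\<in>{1..n} - {k}. set_subst m k {i} ` ?D m) =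
      (\<lambda>i. {i}) ` outer_pos m k ` ({1..n} - {k})"
    by (simp only: image_image UNION_singleton_eq_range cong: SUP_cong)
  have "set_subst m k {k} = image (\<lambda>j. j + k - 1)"
    by (simp add: set_subst_eq_images fun_eq_iff)
  then have inner: "set_subst m k {k} ` ?D m = {{}} \<union> (\<lambda>j. {j}) ` (\<lambda>j. j + k - 1) ` {1..m}"
    by (simp add: image_Un image_image)
  have "(\<Union>I\<in>?D n. set_subst m k I ` ?D m) =
      set_subst m k {} ` ?D m \<union> set_subst m k {k} ` ?D m \<union>
      (\<Union>i\<in>{1..n} - {k}. set_subst m k {i} ` ?D m)"
    using k by blast
  also have "\<dots> = {{}} \<union> (\<lambda>i. {i}) `
      (outer_pos m k ` ({1..n} - {k}) \<union> (\<lambda>j. j + k - 1) ` {1..m})"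
    unfolding empty inner outer by blast
  \<comment> \<open>The vertices of the composite are the renumbered outer inputs other than \<open>k\<close> and the
      renumbered inner inputs, i.e. the substitution of the two full vertex sets.\<close>
  also have "\<dots> = {{}} \<union> (\<lambda>i. {i}) ` set_subst m k {1..n} {1..m}"
    using k by (simp add: set_subst_eq_images)
  also have "\<dots> = ?D (n + m - 1)"
    using set_subst_full[OF k \<open>1 \<le> m\<close>] by simp
  finally show "(\<Union>I\<in>?D n. set_subst m k I ` ?D m) = ?D (n + m - 1)" .
qed

text \<open>
  The composite of two simplices is a simplicial complex, so it is the full simplex as soon as
  it has the full face \<open>{1..n} \<circ>\<^sub>k {1..m} = {1..n + m - 1}\<close>.
\<close>

lemma nonunital_suboperad_simplex: "nonunital_suboperad simplex_complexes scpx_operad"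
proof (rule nonunital_suboperad_scpx_singletonsI[OF complexes_eq(3)])
  show simplex: "Pow {1..n} \<in> scpx n" if "1 \<le> n" for n
    using that by (auto simp: scpx_def)
  show "(\<lambda>I. \<sigma> ` I) ` Pow {1..n} = Pow {1..n}" if "\<sigma> permutes {1..n}" for n :: nat and \<sigma>
    using image_Pow_surj[OF permutes_image[OF that]] .
  fix n m k :: nat assume k: "k \<in> {1..n}" and "1 \<le> m"
  let ?C = "\<Union>I\<in>Pow {1..n}. set_subst m k I ` Pow {1..m}"
  have C: "?C \<in> scpx (n + m - 1)"
    using pcomp_scpx[OF simplex simplex k] k \<open>1 \<le> m\<close> by (simp add: pcomp_scpx_operad_eq_UN)
  have "set_subst m k {1..n} {1..m} \<in> ?C"
    by (rule UN_I[OF Pow_top]) (rule imageI[OF Pow_top])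
  then show "?C = Pow {1..n + m - 1}"
    unfolding set_subst_full[OF k \<open>1 \<le> m\<close>] by (rule scpx_eq_Pow_if_full_face[OF C])
qed

lemma unital_suboperad_discrete: "unital_suboperad discrete_complexes scpx_operad"
  using nonunital_suboperad_discrete unital_operad_scpx
  by (simp add: unital_suboperad_def discrete_complexes_def scpx_operad_simps(4) insert_commute)

lemma unital_suboperad_simplex: "unital_suboperad simplex_complexes scpx_operad"
  using nonunital_suboperad_simplex unital_operad_scpx
  by (simp add: unital_suboperad_def simplex_complexes_def scpx_operad_simps(4) Pow_insert
      insert_commute)

theorem proposition3p11:
  "\<forall>P \<in> {scpx_operad, scpx_ne_operad}.
     nonunital_suboperad trivial_complexes P \<and>
     op_unit P \<notin> trivial_complexes 1 \<and>
     nonunital_operad_iso (P\<lparr>ops := trivial_complexes\<rparr>) Com \<and>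
     unital_suboperad discrete_complexes P \<and>
     unital_operad_iso (P\<lparr>ops := discrete_complexes\<rparr>) Com \<and>
     unital_suboperad simplex_complexes P \<and>
     unital_operad_iso (P\<lparr>ops := simplex_complexes\<rparr>) Com"
proof
  fix P assume P: "P \<in> {scpx_operad, scpx_ne_operad}"
  have ne: "nonunital_suboperad scpx_ne scpx_operad"
    using unital_suboperad_scpx_ne by (simp add: unital_suboperad_def)
  have sub: "Q n \<subseteq> scpx_ne n"
    if "nonunital_suboperad Q scpx_operad" "{} \<notin> Q n" for Q n
    using that by (auto simp: nonunital_suboperad_def scpx_ne_def scpx_operad_simps(1))
  have "{} \<notin> trivial_complexes n" "{} \<notin> discrete_complexes n" "{} \<notin> simplex_complexes n" for n
    by (auto simp: trivial_complexes_def discrete_complexes_def simplex_complexes_def)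
  note sub_ne = sub[OF nonunital_suboperad_trivial this(1)]
    sub[OF nonunital_suboperad_discrete this(2)] sub[OF nonunital_suboperad_simplex this(3)]
  have triv: "nonunital_suboperad trivial_complexes P"
    using P nonunital_suboperad_trivial
      nonunital_suboperad_of_suboperad[OF nonunital_suboperad_trivial ne sub_ne(1)]
    by (auto simp: scpx_ne_operad_def)
  have disc: "unital_suboperad discrete_complexes P"
    using P unital_suboperad_discrete
      unital_suboperad_of_suboperad[OF unital_suboperad_discrete unital_suboperad_scpx_ne sub_ne(2)]
    by (auto simp: scpx_ne_operad_def)
  have simplex: "unital_suboperad simplex_complexes P"
    using P unital_suboperad_simplex
      unital_suboperad_of_suboperad[OF unital_suboperad_simplex unital_suboperad_scpx_ne sub_ne(3)]
    by (auto simp: scpx_ne_operad_def)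
  have "op_unit P = {{}, {1}}"
    using P by (auto simp: scpx_ne_operad_def scpx_operad_simps(4))
  then have unit: "op_unit P \<notin> trivial_complexes 1"
    by (simp add: trivial_complexes_def doubleton_eq_iff)
  have triv_iso: "nonunital_operad_iso (P\<lparr>ops := trivial_complexes\<rparr>) Com"
    using triv complexes_eq(1) by (rule nonunital_iso_Com_if_singletons)
  have disc_iso: "unital_operad_iso (P\<lparr>ops := discrete_complexes\<rparr>) Com"
    using disc complexes_eq(2) by (rule unital_iso_Com_if_singletons)
  have simplex_iso: "unital_operad_iso (P\<lparr>ops := simplex_complexes\<rparr>) Com"
    using simplex complexes_eq(3) by (rule unital_iso_Com_if_singletons)
  show "nonunital_suboperad trivial_complexes P \<and>
     op_unit P \<notin> trivial_complexes 1 \<and>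
     nonunital_operad_iso (P\<lparr>ops := trivial_complexes\<rparr>) Com \<and>
     unital_suboperad discrete_complexes P \<and>
     unital_operad_iso (P\<lparr>ops := discrete_complexes\<rparr>) Com \<and>
     unital_suboperad simplex_complexes P \<and>
     unital_operad_iso (P\<lparr>ops := simplex_complexes\<rparr>) Com"
    by (intro conjI triv unit triv_iso disc disc_iso simplex simplex_iso)
qed

end
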